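(* Let $T$ be an infinite rooted tree, let $0<p<\infty$, let $\psi:T\to\mathbb{C}$, and let $M_\psi:\mathbb{T}_p\to\mathbb{T}_\infty$ be a bounded multiplication operator. Then $M_\psi$ is a compact operator if and only if $$c_n^{1/p}M_\infty(n,\psi)\to0\quad\text{as } n\to\infty,\quad\text{i.e., } M_\infty(n,\psi)=o\big(c_n^{-1/p}\big).$$
   Context: Let $T$ be an infinite rooted tree with root $o$; $T$ also denotes its vertex set. For a vertex $v$, $|v|$ is the number of edges in the unique path from $o$ to $v$. For $n\in\mathbb{N}_0=\{0,1,2,\dots\}$, $D_n=\{v\in T:|v|=n\}$, and $c_n$ is the number of elements of $D_n$, assumed finite for each $n$ (so $1\le c_n<\infty$). For $f:T\to\mathbb{C}$ and $0<p<\infty$ put $M_p(n,f)=\left(\frac1{c_n}\sum_{|v|=n}|f(v)|^p\right)^{1/p}$, and $M_\infty(n,f)=\max_{|v|=n}|f(v)|$. For $0<p\le\infty$ put $\|f\|_p=\sup_{n\in\mathbb{N}_0}M_p(n,f)$ and $\mathbb{T}_p=\{f:T\to\mathbb{C}:\|f\|_p<\infty\}$. For $\psi:T\to\mathbb{C}$, $M_\psi f=\psi f$ (pointwise product). $M_\psi:X\to Y$ is bounded if it maps $X$ into $Y$ and $\sup\{\|\psi f\|_Y/\|f\|_X: f\in X, f\neq0\}<\infty$. It is compact if for every $\|\cdot\|_X$-bounded sequence $\{f_n\}$ in $X$ the sequence $\{\psi f_n\}$ has a subsequence converging in $Y$ with respect to $\|\cdot\|_Y$. *)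

theory Defs
  imports
    "HOL-Analysis.Analysis"
    "HOL-Library.Landau_Symbols"
    "Graph_Theory.Pair_Digraph"
begin

(* A simple graph, possibly infinite, is a loopfree digraph with a symmetric arc set. The constant
   "tree" of Graph_Theory.Digraph_Component is not the right notion here: it excludes directed
   cycles, and in a symmetric digraph every edge gives one (u, v, u). *)
locale rooted_tree = pair_bidirected_digraph T
  for T :: "'a pair_pre_digraph" and r :: 'a +
  assumes root_in_verts: "r \<in> pverts T"
    and unique_path: "\<lbrakk>u \<in> pverts T; v \<in> pverts T\<rbrakk> \<Longrightarrow> \<exists>!\<pi>. pre_digraph.apath (with_proj T) u \<pi> v"

(* Paths are lists of arcs, so the length of a path is its number of edges. *)
definition depth :: "'a pair_pre_digraph \<Rightarrow> 'a \<Rightarrow> 'a \<Rightarrow> nat" where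
  "depth T r v = length (THE \<pi>. pre_digraph.apath (with_proj T) r \<pi> v)"

definition level :: "'a pair_pre_digraph \<Rightarrow> 'a \<Rightarrow> nat \<Rightarrow> 'a set" where
  "level T r n = {v \<in> pverts T. depth T r v = n}"

locale infinite_rooted_tree = rooted_tree +
  assumes infinite_verts: "infinite (pverts T)"
    and finite_level: "finite (level T r n)"

(* A function on the tree is represented by any f :: 'a => complex; nothing below depends on the
   values of f outside pverts T. The exponent ranges over 0 < p <= \<infinity>. *)
definition tree_mean :: "'a pair_pre_digraph \<Rightarrow> 'a \<Rightarrow> ereal \<Rightarrow> nat \<Rightarrow> ('a \<Rightarrow> complex) \<Rightarrow> real" where
  "tree_mean T r p n f =
     (if p = \<infinity> then Max ((\<lambda>v. cmod (f v)) ` level T r n)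
      else (1 / real (card (level T r n)) * (\<Sum>v\<in>level T r n. cmod (f v) powr real_of_ereal p))
             powr (1 / real_of_ereal p))"

definition tree_space :: "'a pair_pre_digraph \<Rightarrow> 'a \<Rightarrow> ereal \<Rightarrow> ('a \<Rightarrow> complex) set" where
  "tree_space T r p = {f. bdd_above (range (\<lambda>n. tree_mean T r p n f))}"

(* The real-valued supremum is meaningful only for f in tree_space T r p. *)
definition tree_norm :: "'a pair_pre_digraph \<Rightarrow> 'a \<Rightarrow> ereal \<Rightarrow> ('a \<Rightarrow> complex) \<Rightarrow> real" where
  "tree_norm T r p f = (SUP n. tree_mean T r p n f)"

definition tree_converges ::
  "'a pair_pre_digraph \<Rightarrow> 'a \<Rightarrow> ereal \<Rightarrow> (nat \<Rightarrow> 'a \<Rightarrow> complex) \<Rightarrow> ('a \<Rightarrow> complex) \<Rightarrow> bool" where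
  "tree_converges T r p F g \<longleftrightarrow>
     (\<forall>k. F k \<in> tree_space T r p) \<and> g \<in> tree_space T r p \<and>
     (\<lambda>k. tree_norm T r p (\<lambda>v. F k v - g v)) \<longlonglongrightarrow> 0"

definition mult_op :: "('a \<Rightarrow> complex) \<Rightarrow> ('a \<Rightarrow> complex) \<Rightarrow> 'a \<Rightarrow> complex" where
  "mult_op \<psi> f = (\<lambda>v. \<psi> v * f v)"

definition mult_op_bounded ::
  "'a pair_pre_digraph \<Rightarrow> 'a \<Rightarrow> ereal \<Rightarrow> ereal \<Rightarrow> ('a \<Rightarrow> complex) \<Rightarrow> bool" where
  "mult_op_bounded T r p q \<psi> \<longleftrightarrow>
     (\<forall>f \<in> tree_space T r p. mult_op \<psi> f \<in> tree_space T r q) \<and>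
     bdd_above {tree_norm T r q (mult_op \<psi> f) / tree_norm T r p f | f.
       f \<in> tree_space T r p \<and> (\<exists>v\<in>pverts T. f v \<noteq> 0)}"

definition mult_op_compact ::
  "'a pair_pre_digraph \<Rightarrow> 'a \<Rightarrow> ereal \<Rightarrow> ereal \<Rightarrow> ('a \<Rightarrow> complex) \<Rightarrow> bool" where
  "mult_op_compact T r p q \<psi> \<longleftrightarrow>
     (\<forall>F :: nat \<Rightarrow> 'a \<Rightarrow> complex.
        (\<forall>k. F k \<in> tree_space T r p) \<and> bdd_above (range (\<lambda>k. tree_norm T r p (F k))) \<longrightarrow>
        (\<exists>s g. strict_mono s \<and> tree_converges T r q (\<lambda>k. mult_op \<psi> (F (s k))) g))"

end

theory Submission
  imports Defs "HOL-Complex_Analysis.Great_Picard"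
begin

text \<open>On level \<open>n\<close> every \<open>f\<close> satisfies \<open>\<bar>f v\<bar> \<le> c\<^sub>n\<^sup>1\<^sup>/\<^sup>p \<parallel>f\<parallel>\<^sub>p\<close>, with equality for a multiple of the indicator
  of a single vertex. If the weights \<open>a\<^sub>n = c\<^sub>n\<^sup>1\<^sup>/\<^sup>p M\<^sub>\<infinity>(n, \<psi>)\<close> tend to 0, the images of a bounded
  sequence are dominated by a multiple of \<open>a\<^sub>n\<close> on level \<open>n\<close>, so a pointwise convergent
  subsequence (the vertex set is countable) converges uniformly: only finitely many vertices lie
  outside the tail. If \<open>a\<^sub>n \<ge> \<epsilon>\<close> infinitely often, normalized indicators of vertices at which \<open>\<bar>\<psi>\<bar>\<close> is
  maximal on those levels have images of norm at least \<open>\<epsilon>\<close> that tend to 0 pointwise, so that no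
  subsequence of the images converges.\<close>

context infinite_rooted_tree
begin

section \<open>Levels of the tree: nonempty, and covering a countable vertex set\<close>

lemma depth_eqI:
  assumes "apath r \<pi> v"
  shows "depth T r v = length \<pi>"
proof -
  have "v \<in> pverts T"
    using assms awalk_last_in_verts by (auto simp: apath_def)
  then have "(THE \<pi>. apath r \<pi> v) = \<pi>"
    using unique_path[OF root_in_verts] assms by (intro the1_equality)
  then show ?thesis
    by (simp add: depth_def)
qed

text \<open>Deleting the last arc of the path from the root to a vertex leaves a path to its parent,
  one level up.\<close>

lemma level_Suc_nonempty:
  assumes "level T r (Suc n) \<noteq> {}"
  shows "level T r n \<noteq> {}"
proof -
  obtain v where v: "v \<in> pverts T" "depth T r v = Suc n"
    using assms by (auto simp: level_def)
  obtain \<pi> where \<pi>: "apath r \<pi> v"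
    using unique_path[OF root_in_verts v(1)] by blast
  with v have "length \<pi> = Suc n"
    using depth_eqI by simp
  then obtain \<rho> e where "\<pi> = \<rho> @ [e]" "length \<rho> = n"
    by (metis length_Suc_conv_rev)
  then obtain u where u: "apath r \<rho> u"
    using \<pi> apath_append_iff by blast
  then have "u \<in> pverts T"
    using awalk_last_in_verts by (auto simp: apath_def)
  with depth_eqI[OF u] \<open>length \<rho> = n\<close> show ?thesis
    by (auto simp: level_def)
qed

text \<open>One empty level would make all later levels empty, leaving only finitely many vertices.
  This makes \<open>Max\<close> over a level and division by its cardinality meaningful.\<close>

lemma level_nonempty: "level T r n \<noteq> {}"
proof
  assume *: "level T r n = {}"
  have empty: "level T r m = {}" if "n \<le> m" for m
    using that by (induction rule: dec_induct) (use * level_Suc_nonempty in blast)+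
  have "pverts T \<subseteq> (\<Union>m<n. level T r m)"
  proof
    fix v assume "v \<in> pverts T"
    then have "v \<in> level T r (depth T r v)"
      by (simp add: level_def)
    with empty show "v \<in> (\<Union>m<n. level T r m)"
      by (metis UN_iff empty_iff lessThan_iff not_le)
  qed
  then have "finite (pverts T)"
    using finite_level by (auto intro: finite_subset)
  with infinite_verts show False ..
qed

lemma card_level_pos: "0 < card (level T r n)"
  using level_nonempty finite_level by (simp add: card_gt_0_iff)

lemma countable_pverts: "countable (pverts T)"
proof -
  have "pverts T \<subseteq> (\<Union>n. level T r n)"
    by (auto simp: level_def)
  then show ?thesis
    by (rule countable_subset) (use finite_level in \<open>auto intro: countable_finite\<close>)
qed

lemma level_depth: "v \<in> pverts T \<Longrightarrow> v \<in> level T r (depth T r v)"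
  by (simp add: level_def)

section \<open>The space for exponent \<infinity> as bounded functions with the sup norm\<close>

lemma tree_mean_infty_upper:
  assumes "v \<in> level T r n"
  shows "cmod (f v) \<le> tree_mean T r \<infinity> n f"
  using assms finite_level by (auto simp: tree_mean_def)

lemma tree_mean_infty_attained:
  obtains v where "v \<in> level T r n" "tree_mean T r \<infinity> n f = cmod (f v)"
proof -
  have "tree_mean T r \<infinity> n f \<in> (\<lambda>v. cmod (f v)) ` level T r n"
    unfolding tree_mean_def using finite_level level_nonempty by (auto intro: Max_in)
  with that show ?thesis
    by auto
qed

lemma tree_mean_infty_nonneg: "0 \<le> tree_mean T r \<infinity> n f"
  by (rule tree_mean_infty_attained[of n f]) simp

lemma tree_mean_infty_le:
  assumes "\<And>v. v \<in> pverts T \<Longrightarrow> cmod (f v) \<le> B"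
  shows "tree_mean T r \<infinity> n f \<le> B"
  by (rule tree_mean_infty_attained[of n f]) (auto simp: level_def assms)

lemma tree_space_inftyI:
  assumes "\<And>v. v \<in> pverts T \<Longrightarrow> cmod (f v) \<le> B"
  shows "f \<in> tree_space T r \<infinity>"
  using tree_mean_infty_le[of f B] assms by (auto simp: tree_space_def intro!: bdd_aboveI)

lemma tree_norm_infty_le:
  assumes "\<And>v. v \<in> pverts T \<Longrightarrow> cmod (f v) \<le> B"
  shows "tree_norm T r \<infinity> f \<le> B"
  unfolding tree_norm_def using tree_mean_infty_le[of f B] assms by (intro cSUP_least) auto

lemma norm_le_tree_norm_infty:
  assumes "f \<in> tree_space T r \<infinity>" "v \<in> pverts T"
  shows "cmod (f v) \<le> tree_norm T r \<infinity> f"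
proof -
  have "cmod (f v) \<le> tree_mean T r \<infinity> (depth T r v) f"
    using assms by (intro tree_mean_infty_upper level_depth)
  also have "\<dots> \<le> tree_norm T r \<infinity> f"
    unfolding tree_norm_def using assms by (intro cSUP_upper) (auto simp: tree_space_def)
  finally show ?thesis .
qed

lemma tree_norm_infty_nonneg:
  assumes "f \<in> tree_space T r \<infinity>"
  shows "0 \<le> tree_norm T r \<infinity> f"
  using norm_le_tree_norm_infty[OF assms root_in_verts] norm_ge_zero order_trans by blast

lemma tree_space_infty_diff:
  assumes "f \<in> tree_space T r \<infinity>" "g \<in> tree_space T r \<infinity>"
  shows "(\<lambda>v. f v - g v) \<in> tree_space T r \<infinity>"
  by (rule tree_space_inftyI[where B = "tree_norm T r \<infinity> f + tree_norm T r \<infinity> g"])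
    (meson add_mono assms norm_le_tree_norm_infty norm_triangle_ineq4 order_trans)

section \<open>Pointwise growth for finite exponent and its extremal functions\<close>

lemma norm_le_tree_mean:
  assumes "0 < p" "v \<in> level T r n"
  shows "cmod (f v) \<le> real (card (level T r n)) powr (1 / p) * tree_mean T r (ereal p) n f"
proof -
  let ?c = "real (card (level T r n))" and ?S = "\<Sum>v\<in>level T r n. cmod (f v) powr p"
  have "cmod (f v) = (cmod (f v) powr p) powr (1 / p)"
    using assms by (simp add: powr_powr)
  \<comment> \<open>One term of a sum of nonnegative terms is at most the sum; undoing the average
    then costs the factor \<open>?c powr (1 / p)\<close>.\<close>
  also have "\<dots> \<le> ?S powr (1 / p)"
    using assms finite_level member_le_sum[of v "level T r n" "\<lambda>v. cmod (f v) powr p"]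
    by (intro powr_mono2) auto
  also have "\<dots> = (?c * (1 / ?c * ?S)) powr (1 / p)"
    using card_level_pos[of n] by simp
  also have "\<dots> = ?c powr (1 / p) * (1 / ?c * ?S) powr (1 / p)"
    by (rule powr_mult)
  finally show ?thesis
    by (simp add: tree_mean_def)
qed

lemma norm_le_tree_norm:
  assumes "0 < p" "f \<in> tree_space T r (ereal p)" "v \<in> level T r n"
  shows "cmod (f v) \<le> real (card (level T r n)) powr (1 / p) * tree_norm T r (ereal p) f"
proof -
  have "tree_mean T r (ereal p) n f \<le> tree_norm T r (ereal p) f"
    unfolding tree_norm_def using assms(2) by (intro cSUP_upper) (auto simp: tree_space_def)
  with norm_le_tree_mean[OF assms(1,3)] show ?thesis
    by (meson mult_left_mono order_trans powr_ge_zero)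
qed

text \<open>Extremal for \<open>norm_le_tree_norm\<close>: the height is the largest that a function
  supported at \<open>u\<close> can have with norm at most 1.\<close>

definition peak :: "real \<Rightarrow> 'a \<Rightarrow> 'a \<Rightarrow> complex" where
  "peak p u = (\<lambda>v. if v = u then of_real (real (card (level T r (depth T r u))) powr (1 / p)) else 0)"

lemma tree_mean_peak:
  assumes "0 < p" "u \<in> pverts T"
  shows "tree_mean T r (ereal p) n (peak p u) = (if n = depth T r u then 1 else 0)"
proof -
  have "(\<Sum>v\<in>level T r n. cmod (peak p u v) powr p) =
      (\<Sum>v\<in>level T r n. if v = u then real (card (level T r (depth T r u))) else 0)"
    using assms by (intro sum.cong) (auto simp: peak_def powr_powr)
  also have "\<dots> = (if n = depth T r u then real (card (level T r n)) else 0)"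
    using assms finite_level[of n] by (auto simp: level_def)
  \<comment> \<open>On the level of \<open>u\<close> the sum cancels the averaging factor; on the
    others the mean is \<open>0 powr (1 / p)\<close>, which is 0.\<close>
  finally show ?thesis
    using card_level_pos[of n] by (auto simp: tree_mean_def)
qed

lemma peak_in_tree_space:
  assumes "0 < p" "u \<in> pverts T"
  shows "peak p u \<in> tree_space T r (ereal p)"
  using assms by (auto simp: tree_space_def tree_mean_peak intro!: bdd_aboveI[of _ 1])

lemma tree_norm_peak_le:
  assumes "0 < p" "u \<in> pverts T"
  shows "tree_norm T r (ereal p) (peak p u) \<le> 1"
  unfolding tree_norm_def using assms by (intro cSUP_least) (auto simp: tree_mean_peak)

section \<open>Sufficiency: domination by a null sequence\<close>

lemma tree_converges_infty_of_dominated: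
  fixes F :: "nat \<Rightarrow> 'a \<Rightarrow> complex"
  assumes dom: "\<And>k n v. v \<in> level T r n \<Longrightarrow> cmod (F k v) \<le> b n" and b: "b \<longlonglongrightarrow> 0"
  shows "\<exists>s g. strict_mono s \<and> tree_converges T r \<infinity> (\<lambda>k. F (s k)) g"
proof -
  obtain B where B: "\<And>n. b n \<le> B"
    using convergent_imp_bounded[OF b] by (metis abs_le_D1 bounded_real rangeI)
  have FB: "cmod (F k v) \<le> B" if "v \<in> pverts T" for k v
    using dom[OF level_depth[OF that]] B order_trans by blast
  \<comment> \<open>Diagonal extraction: the vertices are countable and \<open>B\<close> bounds the
    values at each of them.\<close>
  obtain s where s: "strict_mono s"
    and conv: "\<And>v. v \<in> pverts T \<Longrightarrow> \<exists>l. (\<lambda>k. F (s k) v) \<longlonglongrightarrow> l"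
    using function_convergent_subsequence[OF countable_pverts, of F B] FB by auto
  define g where "g v = lim (\<lambda>k. F (s k) v)" for v
  have lim: "(\<lambda>k. F (s k) v) \<longlonglongrightarrow> g v" if "v \<in> pverts T" for v
    using conv[OF that] by (simp add: g_def convergent_LIMSEQ_iff[symmetric] convergent_def)
  have gb: "cmod (g v) \<le> b n" if "v \<in> level T r n" for n v
    using that dom[OF that] lim[of v]
    by (intro Lim_norm_ubound[of sequentially]) (auto simp: level_def)
  have Fs: "F k \<in> tree_space T r \<infinity>" for k
    by (rule tree_space_inftyI) (rule FB)
  have gs: "g \<in> tree_space T r \<infinity>"
    using gb[OF level_depth] B order_trans by (intro tree_space_inftyI[of _ B]) blast
  have "(\<lambda>k. tree_norm T r \<infinity> (\<lambda>v. F (s k) v - g v)) \<longlonglongrightarrow> 0"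
  proof (rule LIMSEQ_I)
    fix \<epsilon> :: real assume "0 < \<epsilon>"
    \<comment> \<open>From level \<open>N\<close> on, \<open>F (s k)\<close> and \<open>g\<close>
      are both below \<epsilon>/4, so they differ by less than \<epsilon>/2. The slack keeps the
      supremum strictly below \<epsilon>.\<close>
    obtain N where N: "\<And>n. N \<le> n \<Longrightarrow> b n < \<epsilon> / 4"
      using order_tendstoD(2)[OF b, of "\<epsilon> / 4"] \<open>0 < \<epsilon>\<close> by (auto simp: eventually_sequentially)
    \<comment> \<open>Pointwise convergence is uniform on the finitely many vertices above level
      \<open>N\<close>.\<close>
    have "\<forall>\<^sub>F k in sequentially. \<forall>v\<in>(\<Union>n<N. level T r n). dist (F (s k) v) (g v) < \<epsilon> / 2"
    proof (rule eventually_ball_finite)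
      show "finite (\<Union>n<N. level T r n)"
        using finite_level by simp
      show "\<forall>v\<in>(\<Union>n<N. level T r n). \<forall>\<^sub>F k in sequentially. dist (F (s k) v) (g v) < \<epsilon> / 2"
        using \<open>0 < \<epsilon>\<close> by (auto simp only: level_def intro!: tendstoD[OF lim])
    qed
    then obtain K where K: "\<And>k n v. K \<le> k \<Longrightarrow> n < N \<Longrightarrow> v \<in> level T r n \<Longrightarrow> dist (F (s k) v) (g v) < \<epsilon> / 2"
      by (auto simp: eventually_sequentially)
    have "norm (tree_norm T r \<infinity> (\<lambda>v. F (s k) v - g v) - 0) < \<epsilon>" if "K \<le> k" for k
    proof -
      have "cmod (F (s k) v - g v) \<le> \<epsilon> / 2" if v: "v \<in> pverts T" for v
      proof (cases "depth T r v < N")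
        case True
        then show ?thesis
          using K[OF \<open>K \<le> k\<close> True level_depth[OF v]] by (simp add: dist_norm)
      next
        case False
        then show ?thesis
          using norm_triangle_ineq4[of "F (s k) v" "g v"] dom[OF level_depth[OF v], of "s k"]
            gb[OF level_depth[OF v]] N[of "depth T r v"] by linarith
      qed
      then have "tree_norm T r \<infinity> (\<lambda>v. F (s k) v - g v) \<le> \<epsilon> / 2"
        by (rule tree_norm_infty_le)
      moreover have "0 \<le> tree_norm T r \<infinity> (\<lambda>v. F (s k) v - g v)"
        by (intro tree_norm_infty_nonneg tree_space_infty_diff Fs gs)
      ultimately show ?thesis
        using \<open>0 < \<epsilon>\<close> by simp
    qed
    then show "\<exists>no. \<forall>n\<ge>no. norm (tree_norm T r \<infinity> (\<lambda>v. F (s n) v - g v) - 0) < \<epsilon>"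
      by blast
  qed
  with s Fs gs show ?thesis
    by (auto simp: tree_converges_def)
qed

text \<open>With \<open>C\<close> bounding the norms of the \<open>F k\<close>, the growth estimate
  dominates every image on level \<open>n\<close> by \<open>?a n * C\<close>, a null sequence
  independent of \<open>k\<close>.\<close>

lemma mult_op_compactI:
  assumes "0 < p"
    and lim: "(\<lambda>n. real (card (level T r n)) powr (1 / p) * tree_mean T r \<infinity> n \<psi>) \<longlonglongrightarrow> 0"
  shows "mult_op_compact T r (ereal p) \<infinity> \<psi>"
  unfolding mult_op_compact_def
proof (intro allI impI, elim conjE)
  fix F :: "nat \<Rightarrow> 'a \<Rightarrow> complex"
  assume F: "\<forall>k. F k \<in> tree_space T r (ereal p)"
    and bdd: "bdd_above (range (\<lambda>k. tree_norm T r (ereal p) (F k)))"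
  from bdd obtain C where C: "\<And>k. tree_norm T r (ereal p) (F k) \<le> C"
    by (auto simp: bdd_above_def)
  let ?a = "\<lambda>n. real (card (level T r n)) powr (1 / p) * tree_mean T r \<infinity> n \<psi>"
  show "\<exists>s g. strict_mono s \<and> tree_converges T r \<infinity> (\<lambda>k. mult_op \<psi> (F (s k))) g"
  proof (rule tree_converges_infty_of_dominated)
    fix k n v assume v: "v \<in> level T r n"
    have "cmod (F k v) \<le> real (card (level T r n)) powr (1 / p) * C"
      using norm_le_tree_norm[OF \<open>0 < p\<close> _ v] F C by (meson mult_left_mono order_trans powr_ge_zero)
    then have "cmod (\<psi> v) * cmod (F k v)
        \<le> tree_mean T r \<infinity> n \<psi> * (real (card (level T r n)) powr (1 / p) * C)"
      using tree_mean_infty_upper[OF v] tree_mean_infty_nonneg by (intro mult_mono) auto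
    then show "cmod (mult_op \<psi> (F k) v) \<le> ?a n * C"
      by (simp add: mult_op_def norm_mult mult_ac)
  qed (use tendsto_mult_left_zero[OF lim] in simp)
qed

section \<open>Necessity: peaks at the maxima of the symbol\<close>

lemma mult_op_compactD:
  assumes "0 < p" and compact: "mult_op_compact T r (ereal p) \<infinity> \<psi>"
  shows "(\<lambda>n. real (card (level T r n)) powr (1 / p) * tree_mean T r \<infinity> n \<psi>) \<longlonglongrightarrow> 0"
    (is "?a \<longlonglongrightarrow> 0")
proof (rule ccontr)
  assume "\<not> ?a \<longlonglongrightarrow> 0"
  then obtain \<epsilon> where \<epsilon>: "0 < \<epsilon>" "\<And>N. \<exists>n\<ge>N. \<epsilon> \<le> norm (?a n)"
    by (auto simp: LIMSEQ_iff not_less)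
  have inf: "infinite {n. \<epsilon> \<le> ?a n}"
    using \<epsilon>(2) tree_mean_infty_nonneg by (simp add: infinite_nat_iff_unbounded_le)
  define N where "N = enumerate {n. \<epsilon> \<le> ?a n}"
  have N: "strict_mono N" "\<epsilon> \<le> ?a (N k)" for k
    using strict_mono_enumerate[OF inf] enumerate_in_set[OF inf] by (auto simp: N_def)
  have "\<forall>k. \<exists>u. u \<in> level T r (N k) \<and> tree_mean T r \<infinity> (N k) \<psi> = cmod (\<psi> u)"
    using tree_mean_infty_attained by metis
  then obtain u where u: "\<And>k. u k \<in> level T r (N k)"
    "\<And>k. tree_mean T r \<infinity> (N k) \<psi> = cmod (\<psi> (u k))"
    by metis
  have u_verts: "u k \<in> pverts T" and u_depth: "depth T r (u k) = N k" for k
    using u(1)[of k] by (auto simp: level_def)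
  have "bdd_above (range (\<lambda>k. tree_norm T r (ereal p) (peak p (u k))))"
    using tree_norm_peak_le[OF \<open>0 < p\<close> u_verts] by (auto intro!: bdd_aboveI)
  then obtain s g where s: "strict_mono s"
    and conv: "tree_converges T r \<infinity> (\<lambda>k. mult_op \<psi> (peak p (u (s k)))) g"
    using compact peak_in_tree_space[OF \<open>0 < p\<close> u_verts]
    unfolding mult_op_compact_def by (elim allE[of _ "\<lambda>k. peak p (u k)"]) auto
  define d where "d k v = mult_op \<psi> (peak p (u (s k))) v - g v" for k v
  have d_lim: "(\<lambda>k. tree_norm T r \<infinity> (d k)) \<longlonglongrightarrow> 0"
    using conv by (simp add: tree_converges_def d_def[abs_def])
  have "d k \<in> tree_space T r \<infinity>" for k
    unfolding d_def using conv by (intro tree_space_infty_diff) (auto simp: tree_converges_def)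
  then have d_le: "cmod (d k v) \<le> tree_norm T r \<infinity> (d k)" if "v \<in> pverts T" for k v
    using that by (rule norm_le_tree_norm_infty)
  \<comment> \<open>The peaks move to ever deeper levels: once \<open>k\<close> exceeds the depth of
    \<open>v\<close>, the \<open>k\<close>-th peak vanishes at \<open>v\<close>, so
    \<open>d k v\<close> is \<open>- g v\<close>.\<close>
  have g_zero: "g v = 0" if v: "v \<in> pverts T" for v
  proof -
    have "\<forall>\<^sub>F k in sequentially. cmod (g v) \<le> tree_norm T r \<infinity> (d k)"
      using eventually_gt_at_top[of "depth T r v"]
    proof eventually_elim
      case (elim k)
      then have "depth T r v < N (s k)"
        using seq_suble[OF s, of k] seq_suble[OF N(1), of "s k"] by linarith
      then have "v \<noteq> u (s k)"
        using u_depth by auto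
      then show ?case
        using d_le[OF v, of k] by (simp add: d_def mult_op_def peak_def)
    qed
    then have "cmod (g v) \<le> 0"
      using d_lim by (intro tendsto_lowerbound) auto
    then show ?thesis
      by simp
  qed
  have "\<epsilon> \<le> tree_norm T r \<infinity> (d k)" for k
  proof -
    \<comment> \<open>At its own vertex the peak contributes the cardinality factor and \<psi> its
      maximum on the level, while \<open>g\<close> is 0 there.\<close>
    have "?a (N (s k)) = cmod (d k (u (s k)))"
      using g_zero[OF u_verts] u(2)[of "s k"] u_depth
      by (simp add: d_def mult_op_def peak_def norm_mult)
    with N(2)[of "s k"] d_le[OF u_verts, of k "s k"] show ?thesis
      by linarith
  qed
  then have "\<epsilon> \<le> 0"
    using d_lim by (intro tendsto_lowerbound) auto
  with \<open>0 < \<epsilon>\<close> show False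
    by simp
qed

text \<open>Multiplying by the power is dividing by its reciprocal, which is never 0 because levels
  are nonempty; so little-o is the limit of the quotient.\<close>

lemma tendsto_zero_iff_smallo_card_level:
  "(\<lambda>n. real (card (level T r n)) powr q * h n) \<longlonglongrightarrow> 0 \<longleftrightarrow>
    h \<in> o(\<lambda>n. real (card (level T r n)) powr (- q))"
proof -
  have "(\<lambda>n. real (card (level T r n)) powr q * h n) =
      (\<lambda>n. h n / real (card (level T r n)) powr (- q))"
    by (simp add: powr_minus field_simps)
  then show ?thesis
    using card_level_pos by (auto intro: smalloI_tendsto dest: smalloD_tendsto)
qed

end

theorem theorem7:
  fixes T :: "'a pair_pre_digraph" and r :: 'a and p :: real and \<psi> :: "'a \<Rightarrow> complex"
  assumes "infinite_rooted_tree T r"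
    and "0 < p"
    and "mult_op_bounded T r (ereal p) \<infinity> \<psi>"
  shows "(mult_op_compact T r (ereal p) \<infinity> \<psi> \<longleftrightarrow>
           (\<lambda>n. real (card (level T r n)) powr (1 / p) * tree_mean T r \<infinity> n \<psi>) \<longlonglongrightarrow> 0) \<and>
         ((\<lambda>n. real (card (level T r n)) powr (1 / p) * tree_mean T r \<infinity> n \<psi>) \<longlonglongrightarrow> 0 \<longleftrightarrow>
           (\<lambda>n. tree_mean T r \<infinity> n \<psi>) \<in> o(\<lambda>n. real (card (level T r n)) powr (- 1 / p)))"
proof -
  interpret infinite_rooted_tree T r
    by fact
  show ?thesis
    using mult_op_compactI[OF \<open>0 < p\<close>, of \<psi>] mult_op_compactD[OF \<open>0 < p\<close>, of \<psi>]
      tendsto_zero_iff_smallo_card_level[of "1 / p" "\<lambda>n. tree_mean T r \<infinity> n \<psi>"]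
    by auto
qed

end
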